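(* Let $G$ be a finite connected simple graph. Let $(b,d)\in \mathrm{PD}_2(G)$ correspond to the $2$-dimensional homology class $\sigma\in H_2(\widehat{G}^b)$, and let $\omega(\sigma)$ be the width of $\sigma$ in $\widehat{G}^b$. Then $$d\le (\omega(\sigma)+1)\,b.$$
   Context: All homology is simplicial homology with $\mathbb{Z}/2\mathbb{Z}$ coefficients. For a finite connected simple graph $G$ with vertex set $\mathcal{V}$, let $\rho(v,w)$ be the number of edges in a shortest path in $G$ from $v$ to $w$, and let $D=\operatorname{diam}(G)=\max_{v,w\in\mathcal{V}}\rho(v,w)$. For an integer $n\ge 0$, the graph power $G^n$ has vertex set $\mathcal{V}$ and an edge between distinct vertices $v,w$ whenever $\rho(v,w)\le n$. Let $\widehat{G}^n$ be the clique complex of $G^n$: the simplicial complex on $\mathcal{V}$ whose simplices are the nonempty finite sets of vertices with pairwise $\rho$-distances at most $n$. The power filtration is $\widehat{G}^0\subset\widehat{G}^1\subset\cdots\subset\widehat{G}^D$. Persistence diagram: the persistence module $H_k(\widehat{G}^0)\to H_k(\widehat{G}^1)\to\cdots\to H_k(\widehat{G}^D)$ (maps induced by inclusions) decomposes uniquely up to reordering as a direct sum $\bigoplus_{i=1}^N \mathbb{I}_{b_i,d_i}$ of interval modules with $b_i<d_i$, where $\mathbb{I}_{b,d}$ is $\mathbb{Z}/2\mathbb{Z}$ at indices $b,\ldots,d-1$ with identity maps between them, and is $0$ elsewhere (by convention $d=\infty$ if the interval reaches index $D$; this does not occur for $k\ge 1$ because $\widehat{G}^D$ is a full simplex). $\mathrm{PD}_k(G)$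 is the multiset $\{(b_i,d_i)\mid 1\le i\le N\}$. A point $(b,d)\in\mathrm{PD}_k(G)$ corresponds to a class $\sigma\in H_k(\widehat{G}^b)$ if $\sigma$ is born in $\widehat{G}^b$ (it is not in the image of $H_k(\widehat{G}^{b-1})$) and first becomes homologous to earlier features in $\widehat{G}^d$ ($d$ is the smallest $n>b$ such that the image of $\sigma$ in $H_k(\widehat{G}^n)$ lies in the image of $H_k(\widehat{G}^{b-1})\to H_k(\widehat{G}^n)$). For $k\ge1$ all birth times satisfy $b\ge 1$. Width: for $b\ge1$ let $\rho_b(v,w)=\lceil \rho(v,w)/b\rceil$, which is the shortest path distance between $v$ and $w$ in the graph $G^b$. For $Y\subseteq\mathcal{V}$ let $\operatorname{diam}(Y)=\max_{y,y'\in Y}\rho_b(y,y')$ (distances are measured in $G^b$, and the diameter of the empty set is $0$). Let $S$ be a $2$-cycle in $\widehat{G}^b$, let $\mathcal{V}(S)$ be the set of vertices contained in at least one $2$-simplex of $S$, and for $v\in\mathcal{V}(S)$ let $f_v:\mathcal{V}(S)\to\mathbb{R}$, $f_v(w)=\rho_b(v,w)$, and $e_v=\max_{w\in\mathcal{V}(S)}\rho_b(v,w)$. The sweepout $\Lambda(v)$ is the collection of slices $\{f_v^{-1}(i)\mid 0\le i\le e_v\}$. The width of $S$ is $$\omega(S)=\min_{v\in\mathcal{V}(S)}\ \max_{0\le i\le e_v}\operatorname{diam}\left(f_v^{-1}(i)\right),$$ and the width of a homology class $\sigma\in H_2(\widehat{G}^b)$ is $\omega(\sigma)=\min_{S}\omega(S)$,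 the minimum over all $2$-cycles $S$ in $\widehat{G}^b$ representing $\sigma$. *)

theory Defs
  imports
    Complex_Main
    "HOL-Library.Z2"
    "HOL-Library.Multiset"
    "HOL-Library.Extended_Nat"
    "HOL-Algebra.Coset"
    "HOL-Algebra.Product_Groups"
begin

section \<open>Graphs, graph powers and the power filtration\<close>

text \<open>
  A simple graph has a vertex set \<open>V\<close> and a symmetric irreflexive set \<open>E\<close> of
  ordered pairs: the edge between \<open>v\<close> and \<open>w\<close> is present as both \<open>(v, w)\<close> and \<open>(w, v)\<close>.
\<close>

definition finite_connected_simple_graph :: "'a set \<Rightarrow> ('a \<times> 'a) set \<Rightarrow> bool" where
  "finite_connected_simple_graph V E \<longleftrightarrow>
     finite V \<and> V \<noteq> {} \<and> E \<subseteq> V \<times> V \<and> sym E \<and> irrefl E \<and>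
     (\<forall>v\<in>V. \<forall>w\<in>V. (v, w) \<in> E\<^sup>*)"

text \<open>
  \<open>(v, w) \<in> E ^^ n\<close> says that there is a walk with \<open>n\<close> edges from \<open>v\<close> to \<open>w\<close>;
  a walk of minimal length is a path.
\<close>

definition graph_dist :: "('a \<times> 'a) set \<Rightarrow> 'a \<Rightarrow> 'a \<Rightarrow> nat" where
  "graph_dist E v w = (LEAST n. (v, w) \<in> E ^^ n)"

definition graph_diam :: "'a set \<Rightarrow> ('a \<times> 'a) set \<Rightarrow> nat" where
  "graph_diam V E = Max {graph_dist E v w | v w. v \<in> V \<and> w \<in> V}"

definition graph_power :: "'a set \<Rightarrow> ('a \<times> 'a) set \<Rightarrow> nat \<Rightarrow> ('a \<times> 'a) set" where
  "graph_power V E n = {(v, w). v \<in> V \<and> w \<in> V \<and> v \<noteq> w \<and> graph_dist E v w \<le> n}"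

definition clique_complex :: "'a set \<Rightarrow> ('a \<times> 'a) set \<Rightarrow> 'a set set" where
  "clique_complex V E =
     {s. s \<noteq> {} \<and> finite s \<and> s \<subseteq> V \<and> (\<forall>v\<in>s. \<forall>w\<in>s. v \<noteq> w \<longrightarrow> (v, w) \<in> E)}"

definition power_complex :: "'a set \<Rightarrow> ('a \<times> 'a) set \<Rightarrow> nat \<Rightarrow> 'a set set" where
  "power_complex V E n = clique_complex V (graph_power V E n)"


section \<open>Simplicial homology over the field with two elements\<close>

text \<open>
  A complex is its set of nonempty finite simplices.  A \<open>k\<close>-chain is a function from
  sets of vertices to the field \<^typ>\<open>bit\<close> of two elements, vanishing away from the
  \<open>k\<close>-simplices.  \<open>\<int>/2\<int>\<close>-vector spaces are treated as groups: scalar multiplication by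
  \<open>0\<close> and \<open>1\<close> carries no further information, every group homomorphism between them is
  linear, and subgroups and quotient groups are subspaces and quotient spaces.
\<close>

definition simplices :: "'a set set \<Rightarrow> nat \<Rightarrow> 'a set set" where
  "simplices K k = {s \<in> K. card s = Suc k}"

definition chain_group :: "'a set set \<Rightarrow> nat \<Rightarrow> ('a set \<Rightarrow> bit) monoid" where
  "chain_group K k =
     \<lparr>carrier = {c. \<forall>s. c s \<noteq> 0 \<longrightarrow> s \<in> simplices K k},
      monoid.mult = (\<lambda>c c' s. c s + c' s),
      one = (\<lambda>s. 0)\<rparr>"

text \<open>
  The linear extension of \<open>\<partial>s = (\<Sum>v\<in>s. s - {v})\<close>, read off coefficient by coefficient.
  Homology is not reduced: the boundary of a \<open>0\<close>-chain is \<open>0\<close>, since the empty set is not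
  a simplex.
\<close>

definition boundary_map :: "'a set set \<Rightarrow> nat \<Rightarrow> ('a set \<Rightarrow> bit) \<Rightarrow> ('a set \<Rightarrow> bit)" where
  "boundary_map K k c =
     (\<lambda>t. if t = {} then 0 else \<Sum>s | s \<in> simplices K k \<and> (\<exists>v\<in>s. t = s - {v}). c s)"

definition cycles :: "'a set set \<Rightarrow> nat \<Rightarrow> ('a set \<Rightarrow> bit) set" where
  "cycles K k = {c \<in> carrier (chain_group K k). boundary_map K k c = (\<lambda>t. 0)}"

definition boundaries :: "'a set set \<Rightarrow> nat \<Rightarrow> ('a set \<Rightarrow> bit) set" where
  "boundaries K k = boundary_map K (Suc k) ` carrier (chain_group K (Suc k))"

definition cycle_group :: "'a set set \<Rightarrow> nat \<Rightarrow> ('a set \<Rightarrow> bit) monoid" where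
  "cycle_group K k = (chain_group K k)\<lparr>carrier := cycles K k\<rparr>"

text \<open>
  A homology class is a coset of the boundaries, that is, the set of the cycles representing it.
\<close>

definition homology_group :: "'a set set \<Rightarrow> nat \<Rightarrow> ('a set \<Rightarrow> bit) set monoid" where
  "homology_group K k = cycle_group K k Mod boundaries K k"

text \<open>
  The map to \<open>homology_group L k\<close> induced by the inclusion of a subcomplex of \<open>L\<close>.  All
  representatives of a class of the subcomplex have the same class in \<open>L\<close>, so that the
  union is this one class.
\<close>

definition homology_incl :: "'a set set \<Rightarrow> nat \<Rightarrow> ('a set \<Rightarrow> bit) set \<Rightarrow> ('a set \<Rightarrow> bit) set" where
  "homology_incl L k \<sigma> = (\<Union>S\<in>\<sigma>. boundaries L k #>\<^bsub>cycle_group L k\<^esub> S)"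


section \<open>Persistence\<close>

text \<open>
  A persistence module with indices \<open>0, \<dots>, D\<close> consists of spaces \<open>M n\<close> for \<open>n \<le> D\<close> and
  maps \<open>f n\<close> from \<open>M n\<close> to \<open>M (n + 1)\<close> for \<open>n < D\<close>.
\<close>

definition persistence_iso ::
  "nat \<Rightarrow> (nat \<Rightarrow> 'x monoid) \<Rightarrow> (nat \<Rightarrow> 'x \<Rightarrow> 'x) \<Rightarrow>
   (nat \<Rightarrow> 'y monoid) \<Rightarrow> (nat \<Rightarrow> 'y \<Rightarrow> 'y) \<Rightarrow> bool" where
  "persistence_iso D M f N g \<longleftrightarrow>
     (\<exists>\<phi>. (\<forall>n\<le>D. \<phi> n \<in> iso (M n) (N n)) \<and>
          (\<forall>n<D. \<forall>x\<in>carrier (M n). \<phi> (Suc n) (f n x) = g n (\<phi> n x)))"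

definition in_interval :: "nat \<times> enat \<Rightarrow> nat \<Rightarrow> bool" where
  "in_interval p n \<longleftrightarrow> fst p \<le> n \<and> enat n < snd p"

definition interval_space :: "nat \<times> enat \<Rightarrow> nat \<Rightarrow> bit monoid" where
  "interval_space p n =
     \<lparr>carrier = (if in_interval p n then UNIV else {0}), monoid.mult = (+), one = 0\<rparr>"

definition interval_map :: "nat \<times> enat \<Rightarrow> nat \<Rightarrow> bit \<Rightarrow> bit" where
  "interval_map p n x = (if in_interval p n \<and> in_interval p (Suc n) then x else 0)"

text \<open>
  The direct sum of the interval modules of a finite list of points; a finite direct sum is
  a product.
\<close>

definition interval_sum_space :: "(nat \<times> enat) list \<Rightarrow> nat \<Rightarrow> (nat \<Rightarrow> bit) monoid" where
  "interval_sum_space ps n = product_group {..<length ps} (\<lambda>i. interval_space (ps ! i) n)"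

definition interval_sum_map :: "(nat \<times> enat) list \<Rightarrow> nat \<Rightarrow> (nat \<Rightarrow> bit) \<Rightarrow> (nat \<Rightarrow> bit)" where
  "interval_sum_map ps n x = (\<lambda>i\<in>{..<length ps}. interval_map (ps ! i) n (x i))"

text \<open>
  \<open>PD\<close> is the multiset of points of a decomposition into interval modules of the persistence
  module in degree \<open>k\<close> of the power filtration (the decomposition is unique up to
  reordering).  An interval reaching the last index \<open>D\<close> has death time \<open>\<infinity>\<close>, hence every finite
  death time is at most \<open>D\<close>.
\<close>

definition is_persistence_diagram ::
  "'a set \<Rightarrow> ('a \<times> 'a) set \<Rightarrow> nat \<Rightarrow> (nat \<times> enat) multiset \<Rightarrow> bool" where
  "is_persistence_diagram V E k PD \<longleftrightarrow>
     (let D = graph_diam V E in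
      \<exists>ps. PD = mset ps \<and>
           (\<forall>(b, d)\<in>set ps. b \<le> D \<and> enat b < d \<and> (d = \<infinity> \<or> d \<le> enat D)) \<and>
           persistence_iso D
             (\<lambda>n. homology_group (power_complex V E n) k)
             (\<lambda>n. homology_incl (power_complex V E (Suc n)) k)
             (interval_sum_space ps) (interval_sum_map ps))"

text \<open>
  The image in \<open>H\<^sub>k\<close> of stage \<open>n\<close> of the homology of stage \<open>b - 1\<close>; before stage \<open>0\<close> the
  complex is empty and its homology vanishes.
\<close>

definition earlier_classes ::
  "'a set \<Rightarrow> ('a \<times> 'a) set \<Rightarrow> nat \<Rightarrow> nat \<Rightarrow> nat \<Rightarrow> ('a set \<Rightarrow> bit) set set" where
  "earlier_classes V E k b n =
     (if b = 0 then {\<one>\<^bsub>homology_group (power_complex V E n) k\<^esub>}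
      else homology_incl (power_complex V E n) k `
             carrier (homology_group (power_complex V E (b - 1)) k))"

text \<open>
  The point \<open>(b, d)\<close> corresponds to the class \<open>\<sigma>\<close> of stage \<open>b\<close>.  The infimum is over a set
  of indices, so it is the least one if there is any, and \<open>\<infinity>\<close> otherwise.
\<close>

definition corresponds_to ::
  "'a set \<Rightarrow> ('a \<times> 'a) set \<Rightarrow> nat \<Rightarrow> nat \<times> enat \<Rightarrow> ('a set \<Rightarrow> bit) set \<Rightarrow> bool" where
  "corresponds_to V E k p \<sigma> \<longleftrightarrow>
     (case p of (b, d) \<Rightarrow>
       \<sigma> \<in> carrier (homology_group (power_complex V E b) k) \<and>
       \<sigma> \<notin> earlier_classes V E k b b \<and>
       d = Inf {enat n | n. b < n \<and> n \<le> graph_diam V E \<and>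
                  homology_incl (power_complex V E n) k \<sigma> \<in> earlier_classes V E k b n})"


section \<open>Width\<close>

definition scaled_dist :: "('a \<times> 'a) set \<Rightarrow> nat \<Rightarrow> 'a \<Rightarrow> 'a \<Rightarrow> nat" where
  "scaled_dist E b v w = nat \<lceil>real (graph_dist E v w) / real b\<rceil>"

definition scaled_diam :: "('a \<times> 'a) set \<Rightarrow> nat \<Rightarrow> 'a set \<Rightarrow> nat" where
  "scaled_diam E b Y =
     (if Y = {} then 0 else Max {scaled_dist E b y y' | y y'. y \<in> Y \<and> y' \<in> Y})"

definition cycle_vertices :: "('a set \<Rightarrow> bit) \<Rightarrow> 'a set" where
  "cycle_vertices S = \<Union>{s. S s \<noteq> 0}"

definition slice :: "('a \<times> 'a) set \<Rightarrow> nat \<Rightarrow> ('a set \<Rightarrow> bit) \<Rightarrow> 'a \<Rightarrow> nat \<Rightarrow> 'a set" where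
  "slice E b S v i = {w \<in> cycle_vertices S. scaled_dist E b v w = i}"

definition eccentricity :: "('a \<times> 'a) set \<Rightarrow> nat \<Rightarrow> ('a set \<Rightarrow> bit) \<Rightarrow> 'a \<Rightarrow> nat" where
  "eccentricity E b S v = Max (scaled_dist E b v ` cycle_vertices S)"

definition cycle_width :: "('a \<times> 'a) set \<Rightarrow> nat \<Rightarrow> ('a set \<Rightarrow> bit) \<Rightarrow> nat" where
  "cycle_width E b S =
     (MIN v\<in>cycle_vertices S. MAX i\<in>{0..eccentricity E b S v}. scaled_diam E b (slice E b S v i))"

text \<open>
  The elements of \<open>\<sigma>\<close> are the cycles representing it.  For \<open>\<sigma> \<noteq> 0\<close> none of them is \<open>0\<close>, so
  the minima above are over nonempty sets.
\<close>

definition class_width :: "('a \<times> 'a) set \<Rightarrow> nat \<Rightarrow> ('a set \<Rightarrow> bit) set \<Rightarrow> nat" where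
  "class_width E b \<sigma> = (MIN S\<in>\<sigma>. cycle_width E b S)"

end

theory Submission
  imports Defs
begin

text \<open>
  Choose a cycle \<open>S\<close> in \<open>\<sigma>\<close> and a vertex \<open>v\<close> realising the width \<open>\<omega>\<close>, and call
  \<open>\<lceil>\<rho>(v, w) / b\<rceil>\<close> the level of a vertex \<open>w\<close>.  The levels of the vertices of a triangle of
  \<open>S\<close> differ by at most one.  For each \<open>i\<close> let \<open>M\<^sub>i\<close> be the chain of the triangles of \<open>S\<close> meeting
  both of the levels \<open>i\<close> and \<open>i + 1\<close>.  An edge between the two levels lies only in triangles
  of \<open>M\<^sub>i\<close>, so \<open>\<partial>M\<^sub>i\<close> splits into a cycle in each level and can be coned off within
  each level, using vertices of \<open>M\<^sub>i\<close> only.  Any two vertices of \<open>M\<^sub>i\<close> are at distance at most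
  \<open>(\<omega> + 1) b\<close>: move along an edge of \<open>S\<close> to the level of the other one, then within that level.
  Hence the closed-up \<open>M\<^sub>i\<close> bounds in stage \<open>(\<omega> + 1) b\<close>.  What remains of \<open>S\<close> is a sum of
  cycles, each in a single level, and each of them bounds as well.
\<close>

text \<open>
  By default, the simplifier turns \<^term>\<open>x \<noteq> (0 :: bit)\<close> into \<^term>\<open>x = (1 :: bit)\<close> and
  addition into exclusive or, which hides the support of a chain and the additive structure.
\<close>

declare bit_not_zero_iff [simp del] bit_not_one_iff [simp del] add_bit_eq_xor [simp del]

lemma bit_add_self [simp]: "x + x = 0" for x :: bit
  using minus_bit_def by (metis diff_self)

lemma bit_add_self_left [simp]: "x + (x + y) = y" for x y :: bit
  by (simp flip: add.assoc)


section \<open>Chains and cones\<close>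

text \<open>
  The augmented boundary operator of the full simplex on \<open>V\<close>.  It refers neither to a complex
  nor to a degree, so that chains of different stages of the filtration can be compared.
\<close>

definition bd :: "'a set \<Rightarrow> ('a set \<Rightarrow> bit) \<Rightarrow> 'a set \<Rightarrow> bit" where
  "bd V c t = (\<Sum>v\<in>V - t. c (insert v t))"

text \<open>The index counts vertices, one more than the dimension: triangles have index 3, and
  index 0 belongs to the empty simplex of the augmented complex.\<close>

definition chain_on :: "nat \<Rightarrow> 'a set \<Rightarrow> ('a set \<Rightarrow> bit) \<Rightarrow> bool" where
  "chain_on k Q c \<longleftrightarrow> (\<forall>s. c s \<noteq> 0 \<longrightarrow> s \<subseteq> Q \<and> card s = k)"

text \<open>Different simplices may lie in different levels; such a chain is a sum of chains inside
  single levels.\<close>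

definition level_chain :: "('a \<Rightarrow> 'b) \<Rightarrow> ('a set \<Rightarrow> bit) \<Rightarrow> bool" where
  "level_chain l c \<longleftrightarrow> (\<forall>s. c s \<noteq> 0 \<longrightarrow> (\<forall>u\<in>s. \<forall>w\<in>s. l u = l w))"

lemma bit_eq_iff_nonzero: "x = y" if "x \<noteq> 0 \<longleftrightarrow> y \<noteq> 0" for x y :: bit
  using that by (cases x; cases y) auto

lemma bd_add: "bd V (\<lambda>t. c t + c' t) t = bd V c t + bd V c' t"
  by (simp add: bd_def sum.distrib)

lemma bd_zero [simp]: "bd V (\<lambda>t. 0) t = 0"
  by (simp add: bd_def)

lemma bd_sum: "bd V (\<lambda>t. \<Sum>i\<in>I. c i t) t = (\<Sum>i\<in>I. bd V (c i) t)"
  unfolding bd_def by (rule sum.swap)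

lemma bd_nonzeroE:
  assumes "bd V c t \<noteq> 0"
  obtains v where "v \<in> V - t" "c (insert v t) \<noteq> 0"
  using assms unfolding bd_def by (meson sum.neutral)

text \<open>Every unordered pair is counted twice, hence cancels in characteristic two. In the
  induction the new row and the new column cancel.\<close>

lemma sum_sym_offdiag_bit:
  fixes f :: "'a \<Rightarrow> 'a \<Rightarrow> bit"
  assumes "finite A" "\<And>x y. f x y = f y x"
  shows "(\<Sum>x\<in>A. \<Sum>y\<in>A - {x}. f x y) = 0"
  using assms(1)
proof (induction A)
  case (insert a A)
  have "(\<Sum>y\<in>insert a A - {x}. f x y) = f x a + (\<Sum>y\<in>A - {x}. f x y)" if "x \<in> A" for x
  proof -
    have "insert a A - {x} = insert a (A - {x})" using insert that by auto
    then show ?thesis using insert by simp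
  qed
  then have "(\<Sum>x\<in>A. \<Sum>y\<in>insert a A - {x}. f x y) = (\<Sum>x\<in>A. f x a)"
    using insert by (simp add: sum.distrib)
  moreover have "insert a A - {a} = A" using insert by auto
  ultimately show ?case using insert assms(2)[of a] by simp
qed simp

lemma bd_bd:
  assumes "finite V"
  shows "bd V (bd V c) t = 0"
proof -
  have "bd V (bd V c) t = (\<Sum>v\<in>V - t. \<Sum>u\<in>(V - t) - {v}. c (insert u (insert v t)))"
    unfolding bd_def by (intro sum.cong) auto
  also have "\<dots> = 0"
    by (rule sum_sym_offdiag_bit) (use assms in \<open>auto simp: insert_commute\<close>)
  finally show ?thesis .
qed

lemma chain_on_bd:
  assumes "finite Q" "chain_on (Suc k) Q c"
  shows "chain_on k Q (bd V c)"
  unfolding chain_on_def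
proof (intro allI impI)
  fix t assume "bd V c t \<noteq> 0"
  then obtain v where v: "v \<in> V - t" "c (insert v t) \<noteq> 0" by (rule bd_nonzeroE)
  then have *: "insert v t \<subseteq> Q" "card (insert v t) = Suc k"
    using assms(2) v(2) unfolding chain_on_def by metis+
  then have "t \<subseteq> Q" by simp
  moreover from this have "finite t" by (rule finite_subset) (rule assms(1))
  ultimately show "t \<subseteq> Q \<and> card t = k" using *(2) v(1) by simp
qed

text \<open>For the cone \<open>w * c\<close> this is \<open>bd (w * c) = c + w * bd c\<close>. It
  holds even if \<open>c\<close> has simplices through \<open>w\<close>, which the cone drops: for
  \<open>w \<in> t\<close>, the summand \<open>v = w\<close> of \<open>bd V c (t - {w})\<close> is
  \<open>c t\<close> and cancels the first term.\<close>

lemma bd_cone: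
  assumes "finite V" "w \<in> V"
  shows "bd V (\<lambda>t. if w \<in> t then c (t - {w}) else 0) t
       = c t + (if w \<in> t then bd V c (t - {w}) else 0)"
proof (cases "w \<in> t")
  case True
  have eq: "V - (t - {w}) = insert w (V - t)" using True assms by auto
  have "bd V c (t - {w}) = c t + (\<Sum>v\<in>V - t. c (insert v (t - {w})))"
    unfolding bd_def eq using True assms by (simp add: insert_absorb)
  moreover have "(\<Sum>v\<in>V - t. c (insert v (t - {w}))) = (\<Sum>v\<in>V - t. c (insert v t - {w}))"
    using True by (intro sum.cong refl arg_cong[of _ _ c]) auto
  ultimately show ?thesis using True by (simp add: bd_def add.assoc[symmetric])
next
  case False
  then have "(\<Sum>v\<in>V - t. if w \<in> insert v t then c (insert v t - {w}) else 0)
     = (\<Sum>v\<in>V - t. if w = v then c t else 0)"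
    by (intro sum.cong) auto
  then show ?thesis using False assms by (simp add: bd_def)
qed

text \<open>The full simplex on \<open>Q\<close> is acyclic: cone off \<open>c\<close> from any
  vertex of \<open>Q\<close>. If \<open>Q\<close> is empty there is no apex, but then
  \<open>c\<close> vanishes, since its simplices are nonempty.\<close>

lemma simplex_filling:
  assumes "finite V" "Q \<subseteq> V" "chain_on (Suc k) Q c" "bd V c = (\<lambda>t. 0)"
  obtains T where "chain_on (Suc (Suc k)) Q T" "bd V T = c"
proof (cases "Q = {}")
  case True
  have "c s = 0" for s
  proof (rule ccontr)
    assume "c s \<noteq> 0"
    then have "s = {}" "card s = Suc k" using assms(3) True unfolding chain_on_def by blast+
    then show False by simp
  qed
  then have "c = (\<lambda>t. 0)" by (rule ext)
  then show thesis
    by (intro that[of "\<lambda>t. 0"]) (auto simp: chain_on_def)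
next
  case False
  then obtain w where w: "w \<in> Q" by auto
  then have wV: "w \<in> V" using assms(2) by auto
  define T where "T = (\<lambda>t. if w \<in> t then c (t - {w}) else 0)"
  have "bd V T = c"
    unfolding T_def by (rule ext) (simp add: bd_cone[OF assms(1) wV] assms(4))
  moreover have "chain_on (Suc (Suc k)) Q T"
    unfolding chain_on_def
  proof (intro allI impI)
    fix t assume "T t \<noteq> 0"
    then have *: "w \<in> t" "c (t - {w}) \<noteq> 0" by (auto simp: T_def split: if_splits)
    then have **: "t - {w} \<subseteq> Q" "card (t - {w}) = Suc k"
      using assms(3) unfolding chain_on_def by metis+
    then have "finite (t - {w})" by (intro card_ge_0_finite) simp
    then have "card t = Suc (Suc k)" using card_Suc_Diff1[of t w] *(1) **(2) by simp
    then show "t \<subseteq> Q \<and> card t = Suc (Suc k)" using **(1) w by blast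
  qed
  ultimately show thesis using that by blast
qed

text \<open>A nonempty face lies in the level of every simplex of \<open>c\<close> through it, so
  simplices of different levels cannot cancel there. The index \<open>Suc (Suc k)\<close> keeps
  faces nonempty; single points of all levels would share the empty face.\<close>

lemma bd_level_part:
  assumes "chain_on (Suc (Suc k)) Q c" "level_chain l c" "bd V c = (\<lambda>t. 0)"
  shows "bd V (\<lambda>s. if l ` s = {j} then c s else 0) t = 0"
proof (cases "l ` t = {j}")
  case True
  have "bd V (\<lambda>s. if l ` s = {j} then c s else 0) t = bd V c t"
    unfolding bd_def
  proof (intro sum.cong refl)
    fix v assume "v \<in> V - t"
    have "l ` insert v t = {j}" if "c (insert v t) \<noteq> 0"
      
    proof -
      obtain y where "y \<in> t" "l y = j" using True by blast
      moreover have "l v = l y"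
        using that assms(2) \<open>y \<in> t\<close> unfolding level_chain_def by (metis insertCI)
      ultimately show ?thesis using True by simp
    qed
    then show "(if l ` insert v t = {j} then c (insert v t) else 0) = c (insert v t)"
      by metis
  qed
  then show ?thesis by (simp add: assms(3))
next
  case False
  show ?thesis
  proof (rule ccontr)
    assume "\<not> ?thesis"
    then obtain v where "(if l ` insert v t = {j} then c (insert v t) else 0) \<noteq> 0"
      by (rule bd_nonzeroE)
    then have v: "l ` insert v t = {j}" "c (insert v t) \<noteq> 0" by presburger+
    then have "card (insert v t) = Suc (Suc k)" using assms(1) unfolding chain_on_def by metis
    then have "t \<noteq> {}" by force
    moreover have "l ` t \<subseteq> {j}" using v(1) by (metis image_insert subset_insertI)
    ultimately show False using False by (metis image_is_empty subset_singletonD)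
  qed
qed

text \<open>The part of \<open>c\<close> in each level is a cycle by \<open>bd_level_part\<close>
  and bounds in the full simplex on the vertices of that level. Summing over the finitely many
  levels met by \<open>Q\<close> fills \<open>c\<close>.\<close>

lemma level_filling:
  assumes "finite V" "Q \<subseteq> V" "chain_on (Suc (Suc k)) Q c" "level_chain l c" "bd V c = (\<lambda>t. 0)"
  obtains T where "chain_on (Suc (Suc (Suc k))) Q T" "level_chain l T" "bd V T = c"
proof -
  define part where "part j = (\<lambda>s. if l ` s = {j} then c s else 0)" for j
  have "\<exists>T. chain_on (Suc (Suc (Suc k))) {q\<in>Q. l q = j} T \<and> bd V T = part j" for j
  proof -
    have "chain_on (Suc (Suc k)) {q\<in>Q. l q = j} (part j)"
      using assms(3) by (auto simp: chain_on_def part_def split: if_splits)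
    moreover have "bd V (part j) = (\<lambda>t. 0)"
      unfolding part_def using bd_level_part[OF assms(3-5)] by auto
    ultimately show ?thesis
      using simplex_filling[OF assms(1), of "{q\<in>Q. l q = j}" "Suc k" "part j"] assms(2)
      by (metis (no_types, lifting) mem_Collect_eq subset_iff)
  qed
  then obtain T where T: "\<And>j. chain_on (Suc (Suc (Suc k))) {q\<in>Q. l q = j} (T j)"
      "\<And>j. bd V (T j) = part j" by metis
  define U where "U = (\<lambda>t. \<Sum>j\<in>l ` Q. T j t)"
  have nz: "\<exists>j. T j t \<noteq> 0" if "U t \<noteq> 0" for t
    using that unfolding U_def by (meson sum.neutral)
  have finQ: "finite (l ` Q)" using assms finite_subset by blast
  have "bd V U t = c t" for t
  proof -
    have "bd V U t = (\<Sum>j\<in>l ` Q. part j t)"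
      unfolding U_def bd_sum T(2) ..
    also have "\<dots> = c t"
    proof (cases "c t = 0")
      case False
      then have t: "t \<subseteq> Q" "card t = Suc (Suc k)" "\<forall>u\<in>t. \<forall>w\<in>t. l u = l w"
        using assms(3,4) unfolding chain_on_def level_chain_def by blast+
      then obtain x where x: "x \<in> t" by fastforce
      then have lt: "l ` t = {l x}" using t(3) by blast
      have "(\<Sum>j\<in>l ` Q. part j t) = (\<Sum>j\<in>l ` Q. if j = l x then c t else 0)"
        by (intro sum.cong) (auto simp: part_def lt)
      moreover have "l x \<in> l ` Q" using x t by blast
      ultimately show ?thesis using finQ by simp
    next
      case True
      then show ?thesis by (simp add: part_def cong: if_cong)
    qed
    finally show ?thesis .
  qed
  moreover have "chain_on (Suc (Suc (Suc k))) Q U" "level_chain l U"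
  proof -
    have *: "t \<subseteq> Q \<and> card t = Suc (Suc (Suc k)) \<and> (\<forall>u\<in>t. \<forall>w\<in>t. l u = l w)" if U: "U t \<noteq> 0" for t
    proof -
      obtain j where "T j t \<noteq> 0" using nz[OF U] by blast
      then have "t \<subseteq> {q\<in>Q. l q = j}" "card t = Suc (Suc (Suc k))"
        using T(1) unfolding chain_on_def by blast+
      then show ?thesis by auto
    qed
    then show "chain_on (Suc (Suc (Suc k))) Q U" "level_chain l U"
      unfolding chain_on_def level_chain_def by blast+
  qed
  ultimately show thesis using that by blast
qed

section \<open>Filling a cycle along a sweepout\<close>

lemma proper_subset_doubleton_eq:
  assumes "A \<subseteq> {a, b}" "A \<noteq> {a, b}" "x \<in> A" "y \<in> A"
  shows "x = y"
proof (rule ccontr)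
  assume "x \<noteq> y"
  then have "{a, b} = {x, y}" using assms by auto
  then show False using assms by auto
qed

text \<open>The combinatorial core, free of distances: \<open>R\<close> stands for being close
  enough to span a simplex of the target stage. The last hypothesis encodes one move inside a
  triangle followed by one move inside a level.\<close>

lemma sweepout_filling:
  fixes l :: "'a \<Rightarrow> nat"
  assumes V: "finite V" and S: "chain_on 3 V S" and cyc: "bd V S = (\<lambda>t. 0)"
    and step: "\<And>s u w. S s \<noteq> 0 \<Longrightarrow> u \<in> s \<Longrightarrow> w \<in> s \<Longrightarrow> l u \<le> Suc (l w)"
    and R: "\<And>s u u' w. S s \<noteq> 0 \<Longrightarrow> u \<in> s \<Longrightarrow> u' \<in> s \<Longrightarrow> w \<in> cycle_vertices S \<Longrightarrow> l u' = l w \<Longrightarrow> R u w"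
  obtains T where "chain_on 4 V T" "\<And>t u w. T t \<noteq> 0 \<Longrightarrow> u \<in> t \<Longrightarrow> w \<in> t \<Longrightarrow> R u w" "bd V T = S"
proof -
  define M where "M i = (\<lambda>s. if l ` s = {i, Suc i} then S s else 0)" for i
  define Q where "Q i = \<Union>{s. M i s \<noteq> 0}" for i
  have MS: "M i s \<noteq> 0 \<longleftrightarrow> S s \<noteq> 0 \<and> l ` s = {i, Suc i}" for i s
    by (auto simp: M_def)
  have QV: "Q i \<subseteq> V" for i using S by (auto simp: Q_def MS chain_on_def)
  have QC: "Q i \<subseteq> cycle_vertices S" for i by (auto simp: Q_def MS cycle_vertices_def)
  \<comment> \<open>The triangle of \<open>u\<close> meets both levels \<open>i\<close> and
    \<open>i + 1\<close>, so it has a vertex \<open>u'\<close> on the level of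
    \<open>w\<close>.\<close>
  have clique: "R u w" if u: "u \<in> Q i" and w: "w \<in> Q i" for i u w
  proof -
    obtain s where s: "S s \<noteq> 0" "l ` s = {i, Suc i}" "u \<in> s"
      using u by (auto simp: Q_def MS)
    obtain s' where s': "S s' \<noteq> 0" "l ` s' = {i, Suc i}" "w \<in> s'"
      using w by (auto simp: Q_def MS)
    then have "l w \<in> l ` s" using s(2) by blast
    then obtain u' where "u' \<in> s" "l u' = l w" by auto
    then show ?thesis using R[OF s(1,3)] QC w by blast
  qed
  have MQ: "chain_on 3 (Q i) (M i)" for i
    using S by (auto simp: chain_on_def MS Q_def)
  have bdM: "level_chain l (bd V (M i))" for i
    unfolding level_chain_def
  proof (intro allI impI)
    fix t assume nz: "bd V (M i) t \<noteq> 0"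
    then obtain v where v: "v \<in> V - t" "l ` insert v t = {i, Suc i}"
      by (elim bd_nonzeroE) (auto simp: MS)
    have "l ` t \<noteq> {i, Suc i}"
    proof
      \<comment> \<open>All triangles of \<open>S\<close> through an edge between the two levels
        belong to \<open>M i\<close>, so \<open>M i\<close> inherits the vanishing boundary
        coefficient of \<open>S\<close>.\<close>
      assume lt: "l ` t = {i, Suc i}"
      have "bd V (M i) t = bd V S t"
        unfolding bd_def
      proof (intro sum.cong refl bit_eq_iff_nonzero)
        fix x
        have "l ` insert x t = {i, Suc i}" if Sx: "S (insert x t) \<noteq> 0"
        proof -
          obtain p q where "p \<in> t" "l p = i" "q \<in> t" "l q = Suc i"
            using lt by (metis imageE insertI1 insertI2)
          \<comment> \<open>The end \<open>p\<close> bounds the level of the third vertex from above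
            by \<open>i + 1\<close>, the end \<open>q\<close> from below by
            \<open>i\<close>.\<close>
          then have "l x \<le> Suc i" "Suc i \<le> Suc (l x)"
            using step[OF Sx, of x p] step[OF Sx, of q x] by auto
          then show ?thesis using lt by auto
        qed
        then show "M i (insert x t) \<noteq> 0 \<longleftrightarrow> S (insert x t) \<noteq> 0" by (auto simp: MS)
      qed
      then show False using nz cyc by simp
    qed
    moreover have "l ` t \<subseteq> {i, Suc i}" using v(2) by (metis image_insert subset_insertI)
    ultimately show "\<forall>u\<in>t. \<forall>w\<in>t. l u = l w"
      using proper_subset_doubleton_eq[of "l ` t" i "Suc i"] by (intro ballI) simp
  qed
  \<comment> \<open>The caps \<open>X i\<close> use only vertices of \<open>Q i\<close>, so that
    \<open>clique\<close> still applies to the closed-up band \<open>N i\<close>.\<close>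
  have "\<exists>X. chain_on 3 (Q i) X \<and> level_chain l X \<and> bd V X = bd V (M i)" for i
  proof -
    have "finite (Q i)" using QV V finite_subset by blast
    then have "chain_on 2 (Q i) (bd V (M i))"
      using chain_on_bd[of "Q i" 2 "M i"] MQ[of i] by (simp add: numeral_eq_Suc)
    then show ?thesis
      using level_filling[OF V QV, of 0 i "bd V (M i)" l] bdM[of i] bd_bd[OF V, of "M i"]
      by (metis (no_types, lifting) ext numeral_2_eq_2 numeral_3_eq_3)
  qed
  then obtain X where X: "\<And>i. chain_on 3 (Q i) (X i)" "\<And>i. level_chain l (X i)"
      "\<And>i. bd V (X i) = bd V (M i)" by metis
  define N where "N i = (\<lambda>t. M i t + X i t)" for i
  have NQ: "chain_on 3 (Q i) (N i)" for i
    using MQ[of i] X(1)[of i] unfolding chain_on_def N_def by (metis add_0)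
  have bdN: "bd V (N i) = (\<lambda>t. 0)" for i
    unfolding N_def by (auto simp: bd_add X)
  have "\<exists>T. chain_on 4 (Q i) T \<and> bd V T = N i" for i
    using simplex_filling[OF V QV, of 2 i "N i"] NQ[of i] bdN[of i]
    by (auto simp: numeral_eq_Suc)
  then obtain T where T: "\<And>i. chain_on 4 (Q i) (T i)" "\<And>i. bd V (T i) = N i" by metis
  define I where "I = l ` V"
  have I: "finite I" using V by (auto simp: I_def)
  \<comment> \<open>In characteristic two, adding the bands removes them from \<open>S\<close>; what
    is left are triangles inside single levels.\<close>
  define S' where "S' = (\<lambda>t. S t + (\<Sum>i\<in>I. N i t))"
  have "chain_on 3 (cycle_vertices S) S'"
  proof -
    have N: "\<exists>i. N i t \<noteq> 0" if "S' t \<noteq> 0" "S t = 0" for t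
      using that unfolding S'_def by (metis add_0 sum.neutral)
    have "t \<subseteq> cycle_vertices S \<and> card t = 3" if nzt: "S' t \<noteq> 0" for t
    proof (cases "S t = 0")
      case True
      then obtain i where "N i t \<noteq> 0" using N[OF nzt] by blast
      then show ?thesis using NQ[of i] QC[of i] unfolding chain_on_def by blast
    next
      case False
      then show ?thesis using S by (auto simp: chain_on_def cycle_vertices_def)
    qed
    then show ?thesis by (simp add: chain_on_def)
  qed
  moreover have "level_chain l S'"
    unfolding level_chain_def
  proof (intro allI impI)
    fix t assume nz: "S' t \<noteq> 0"
    show "\<forall>u\<in>t. \<forall>w\<in>t. l u = l w"
    proof (rule ccontr)
      \<comment> \<open>On a simplex meeting two levels the caps vanish, and \<open>S t\<close> is
        cancelled by the single band at its lower level.\<close>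
      assume nonconst: "\<not> ?thesis"
      then have "X i t = 0" for i using X(2)[of i] by (auto simp: level_chain_def)
      then have eq: "S' t = S t + (\<Sum>i\<in>I. M i t)" by (simp add: S'_def N_def)
      show False
      proof (cases "S t = 0")
        case True
        then show False using nz eq by (simp add: M_def cong: if_cong)
      next
        case False
        obtain p q where pq: "p \<in> t" "q \<in> t" "l p \<noteq> l q" using nonconst by blast
        then have "(\<exists>u\<in>t. \<exists>w\<in>t. l u < l w)"
          by (metis nat_neq_iff)
        then obtain u w where uw: "u \<in> t" "w \<in> t" "l u < l w" by blast
        then have lw: "l w = Suc (l u)" using step[OF False uw(2,1)] by simp
        have lt: "l ` t = {l u, Suc (l u)}"
        proof -
          have "l x \<in> {l u, Suc (l u)}" if "x \<in> t" for x
            using step[OF False that uw(1)] step[OF False uw(2) that] lw by auto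
          then have "l ` t \<subseteq> {l u, Suc (l u)}" by blast
          moreover have "{l u, Suc (l u)} \<subseteq> l ` t" using uw by (simp flip: lw)
          ultimately show ?thesis by (rule subset_antisym)
        qed
        \<comment> \<open>The set \<open>{i, Suc i}\<close> determines \<open>i\<close>, so exactly
          one band contains \<open>t\<close>.\<close>
        have "(\<Sum>i\<in>I. M i t) = (\<Sum>i\<in>I. if i = l u then S t else 0)"
          by (intro sum.cong) (auto simp: M_def lt doubleton_eq_iff)
        moreover have "l u \<in> I" using False S uw by (auto simp: I_def chain_on_def)
        ultimately show False using nz eq I by simp
      qed
    qed
  qed
  moreover have "bd V S' = (\<lambda>t. 0)"
    unfolding S'_def by (auto simp: bd_add bd_sum cyc bdN)
  moreover have CV: "cycle_vertices S \<subseteq> V" using S by (auto simp: cycle_vertices_def chain_on_def)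
  ultimately obtain T' where T': "chain_on 4 (cycle_vertices S) T'" "level_chain l T'" "bd V T' = S'"
    using level_filling[OF V CV, of 1 S' l] by (auto simp: numeral_eq_Suc)
  define U where "U = (\<lambda>t. T' t + (\<Sum>i\<in>I. T i t))"
  have U: "(\<exists>i. T i t \<noteq> 0) \<or> T' t \<noteq> 0" if "U t \<noteq> 0" for t
    using that unfolding U_def by (metis add_0 sum.neutral)
  have "t \<subseteq> V \<and> card t = 4" if "U t \<noteq> 0" for t
    using U[OF that]
  proof
    assume "\<exists>i. T i t \<noteq> 0"
    then obtain i where "T i t \<noteq> 0" ..
    then show ?thesis using T(1)[of i] QV[of i] unfolding chain_on_def by blast
  next
    assume "T' t \<noteq> 0"
    then show ?thesis using T'(1) CV unfolding chain_on_def by blast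
  qed
  then have "chain_on 4 V U" by (simp add: chain_on_def)
  moreover have "R u w" if "U t \<noteq> 0" "u \<in> t" "w \<in> t" for t u w
    using U[OF that(1)]
  proof
    assume "\<exists>i. T i t \<noteq> 0"
    then obtain i where "T i t \<noteq> 0" ..
    then have "t \<subseteq> Q i" using T(1)[of i] unfolding chain_on_def by blast
    then show ?thesis using clique[of u i w] that by blast
  next
    \<comment> \<open>Both vertices share a level, so the hypothesis on \<open>R\<close> applies
      with the trivial first move \<open>u' = u\<close>.\<close>
    assume "T' t \<noteq> 0"
    then have *: "t \<subseteq> cycle_vertices S" "l u = l w"
      using T'(1,2) that(2,3) unfolding chain_on_def level_chain_def by metis+
    then have "u \<in> cycle_vertices S" using that(2) by blast
    then obtain s where "S s \<noteq> 0" "u \<in> s" unfolding cycle_vertices_def by blast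
    moreover have "w \<in> cycle_vertices S" using * that by blast
    ultimately show ?thesis using R[of s u u w] * by blast
  qed
  moreover have "bd V U = S"
    unfolding U_def by (auto simp: bd_add bd_sum T T' S'_def add.assoc)
  ultimately show thesis using that by blast
qed


section \<open>Homology classes\<close>

lemma chain_group_iff:
  "c \<in> carrier (chain_group K k) \<longleftrightarrow> (\<forall>s. c s \<noteq> 0 \<longrightarrow> s \<in> K \<and> card s = Suc k)"
  by (simp add: chain_group_def simplices_def)

lemma cycle_group_mult [simp]: "c \<otimes>\<^bsub>cycle_group K k\<^esub> c' = (\<lambda>s. c s + c' s)"
  by (simp add: cycle_group_def chain_group_def)

lemma chain_group_add:
  assumes "c \<in> carrier (chain_group K k)" "c' \<in> carrier (chain_group K k)"
  shows "(\<lambda>s. c s + c' s) \<in> carrier (chain_group K k)"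
  unfolding chain_group_iff
proof (intro allI impI)
  fix s assume "c s + c' s \<noteq> 0"
  then have "c s \<noteq> 0 \<or> c' s \<noteq> 0" by auto
  then show "s \<in> K \<and> card s = Suc k" using assms unfolding chain_group_iff by blast
qed

lemma boundary_map_add:
  "boundary_map K k (\<lambda>s. c s + c' s) = (\<lambda>t. boundary_map K k c t + boundary_map K k c' t)"
  by (rule ext) (simp add: boundary_map_def sum.distrib)

text \<open>The conventions differ at the empty face, where both sides vanish because the degree is
  positive. Elsewhere the extra summands of \<open>bd\<close> are zero, since \<open>c\<close> is
  supported on simplices of \<open>K\<close>.\<close>

lemma boundary_map_eq_bd:
  assumes "finite V" "K \<subseteq> Pow V" and c: "c \<in> carrier (chain_group K (Suc k))"
  shows "boundary_map K (Suc k) c = bd V c"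
proof
  fix t
  show "boundary_map K (Suc k) c t = bd V c t"
  proof (cases "t = {}")
    case True
    have "c {v} = 0" for v
    proof (rule ccontr)
      assume "c {v} \<noteq> 0"
      then have "card {v} = Suc (Suc k)" using c unfolding chain_group_iff by blast
      then show False by simp
    qed
    then show ?thesis using True by (simp add: boundary_map_def bd_def)
  next
    case False
    let ?A = "{s. s \<in> simplices K (Suc k) \<and> (\<exists>v\<in>s. t = s - {v})}"
    let ?I = "(\<lambda>v. insert v t) ` (V - t)"
    have "?A \<subseteq> ?I"
    proof
      fix s assume "s \<in> ?A"
      then obtain v where v: "s \<in> K" "v \<in> s" "t = s - {v}" by (auto simp: simplices_def)
      then have "v \<in> V - t" "s = insert v t" using assms(2) by auto
      then show "s \<in> ?I" by blast
    qed
    moreover have "\<forall>s\<in>?I - ?A. c s = 0"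
    proof (rule ballI, rule ccontr)
      fix s assume s: "s \<in> ?I - ?A" "c s \<noteq> 0"
      then obtain v where "v \<notin> t" "s = insert v t" by auto
      then have "v \<in> s" "t = s - {v}" by auto
      moreover have "s \<in> simplices K (Suc k)" using c s(2) by (simp add: chain_group_iff simplices_def)
      ultimately show False using s(1) by blast
    qed
    ultimately have "sum c ?A = sum c ?I"
      using assms(1) by (intro sum.mono_neutral_left) auto
    also have "inj_on (\<lambda>v. insert v t) (V - t)"
      by (intro inj_onI) auto
    then have "sum c ?I = bd V c t"
      by (simp add: sum.reindex bd_def)
    finally show ?thesis using False by (simp add: boundary_map_def)
  qed
qed

section \<open>Sums of boundaries and their passage to larger complexes\<close>

lemma boundariesE:
  assumes "c \<in> boundaries K k"
  obtains T where "T \<in> carrier (chain_group K (Suc k))" "c = boundary_map K (Suc k) T"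
  using assms unfolding boundaries_def by (rule imageE) (rule that)

lemma boundaries_add:
  assumes "c \<in> boundaries K k" "c' \<in> boundaries K k"
  shows "(\<lambda>s. c s + c' s) \<in> boundaries K k"
proof -
  obtain T T' where "T \<in> carrier (chain_group K (Suc k))" "T' \<in> carrier (chain_group K (Suc k))"
    "c = boundary_map K (Suc k) T" "c' = boundary_map K (Suc k) T'"
    using assms by (elim boundariesE)
  then show ?thesis
    unfolding boundaries_def
    by (intro image_eqI[of _ _ "\<lambda>s. T s + T' s"]) (simp_all only: boundary_map_add chain_group_add)
qed

lemma boundaries_add_iff:
  assumes "c \<in> boundaries K k"
  shows "(\<lambda>s. c s + c' s) \<in> boundaries K k \<longleftrightarrow> c' \<in> boundaries K k"
proof
  assume "(\<lambda>s. c s + c' s) \<in> boundaries K k"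
  from boundaries_add[OF assms this] show "c' \<in> boundaries K k" by simp
qed (rule boundaries_add[OF assms])

lemma zero_in_chain_group: "(\<lambda>s. 0) \<in> carrier (chain_group K k)"
  by (simp add: chain_group_iff)

lemma boundary_map_zero: "boundary_map K k (\<lambda>s. 0) = (\<lambda>t. 0)"
  by (rule ext) (simp add: boundary_map_def)

lemma zero_in_boundaries: "(\<lambda>s. 0) \<in> boundaries K k"
  unfolding boundaries_def
  by (rule image_eqI[OF _ zero_in_chain_group]) (simp only: boundary_map_zero)

text \<open>The same filling works: both boundary maps agree with \<open>bd V\<close>, which does
  not see the complex.\<close>

lemma boundaries_mono:
  assumes "finite V" "L \<subseteq> Pow V" "K \<subseteq> L"
  shows "boundaries K k \<subseteq> boundaries L k"
proof
  fix c assume "c \<in> boundaries K k"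
  then obtain T where T: "T \<in> carrier (chain_group K (Suc k))" "c = boundary_map K (Suc k) T"
    by (rule boundariesE)
  then have TL: "T \<in> carrier (chain_group L (Suc k))"
    using assms(3) unfolding chain_group_iff by blast
  have "c = boundary_map L (Suc k) T"
    using T TL boundary_map_eq_bd[OF assms(1)] assms(2,3) by (metis subset_trans)
  then show "c \<in> boundaries L k" using TL unfolding boundaries_def by blast
qed

text \<open>Besides \<open>bd_bd\<close>, closure under faces is needed to keep the support of a
  boundary inside \<open>K\<close>.\<close>

lemma boundaries_subset_cycles:
  assumes V: "finite V" and K: "K \<subseteq> Pow V"
    and face: "\<And>s t. s \<in> K \<Longrightarrow> t \<subseteq> s \<Longrightarrow> t \<noteq> {} \<Longrightarrow> t \<in> K"
  shows "boundaries K (Suc k) \<subseteq> cycles K (Suc k)"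
proof
  fix c assume "c \<in> boundaries K (Suc k)"
  then obtain T where T: "T \<in> carrier (chain_group K (Suc (Suc k)))" "c = boundary_map K (Suc (Suc k)) T"
    by (rule boundariesE)
  then have c: "c = bd V T" using boundary_map_eq_bd[OF V K T(1)] by simp
  have "chain_on (Suc (Suc (Suc k))) V T"
    unfolding chain_on_def using T(1)[unfolded chain_group_iff] K by (metis PowD subsetD)
  then have chain: "chain_on (Suc (Suc k)) V c"
    unfolding c by (rule chain_on_bd[OF V])
  have "s \<in> K \<and> card s = Suc (Suc k)" if "c s \<noteq> 0" for s
  proof
    show card: "card s = Suc (Suc k)" using chain that unfolding chain_on_def by metis
    obtain v where "T (insert v s) \<noteq> 0" using \<open>c s \<noteq> 0\<close> unfolding c by (rule bd_nonzeroE)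
    then have "insert v s \<in> K" using T(1) unfolding chain_group_iff by metis
    moreover have "s \<noteq> {}" using card by force
    ultimately show "s \<in> K" using face subset_insertI by metis
  qed
  then have cc: "c \<in> carrier (chain_group K (Suc k))" by (simp add: chain_group_iff)
  have "boundary_map K (Suc k) c = bd V c" by (rule boundary_map_eq_bd[OF V K cc])
  also have "\<dots> = (\<lambda>t. 0)" unfolding c by (rule ext) (rule bd_bd[OF V])
  finally show "c \<in> cycles K (Suc k)" using cc by (simp add: cycles_def)
qed

text \<open>Sum and difference coincide in characteristic two. This reduces statements about cosets
  to membership in \<open>boundaries\<close>.\<close>

lemma in_coset_boundaries_iff:
  "x \<in> boundaries K k #>\<^bsub>cycle_group K k\<^esub> c \<longleftrightarrow> (\<lambda>s. x s + c s) \<in> boundaries K k"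
proof
  assume "(\<lambda>s. x s + c s) \<in> boundaries K k"
  moreover have "x = (\<lambda>s. x s + c s) \<otimes>\<^bsub>cycle_group K k\<^esub> c" by (simp add: add.assoc)
  ultimately show "x \<in> boundaries K k #>\<^bsub>cycle_group K k\<^esub> c"
    unfolding r_coset_def by blast
next
  assume "x \<in> boundaries K k #>\<^bsub>cycle_group K k\<^esub> c"
  then obtain h where "h \<in> boundaries K k" "x = (\<lambda>s. h s + c s)"
    unfolding r_coset_def by auto
  then show "(\<lambda>s. x s + c s) \<in> boundaries K k" by (simp add: add.assoc)
qed

lemma coset_boundaries_eq:
  assumes "c \<in> boundaries K k"
  shows "boundaries K k #>\<^bsub>cycle_group K k\<^esub> c = boundaries K k"
proof (rule Set.set_eqI)
  fix x
  show "x \<in> boundaries K k #>\<^bsub>cycle_group K k\<^esub> c \<longleftrightarrow> x \<in> boundaries K k"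
    using boundaries_add_iff[OF assms, of x] by (simp add: in_coset_boundaries_iff add.commute)
qed

section \<open>Homology classes as sets of representatives\<close>

lemma homology_classE:
  assumes "\<sigma> \<in> carrier (homology_group K k)"
  obtains S where "S \<in> cycles K k" "\<sigma> = boundaries K k #>\<^bsub>cycle_group K k\<^esub> S"
proof -
  have "\<sigma> \<in> (\<lambda>S. boundaries K k #>\<^bsub>cycle_group K k\<^esub> S) ` cycles K k"
    using assms by (simp add: homology_group_def carrier_FactGroup cycle_group_def)
  then show thesis by (rule imageE) (rule that)
qed

lemma homology_class_eq_coset:
  assumes "\<sigma> \<in> carrier (homology_group K k)" "S \<in> \<sigma>"
  shows "\<sigma> = boundaries K k #>\<^bsub>cycle_group K k\<^esub> S"
proof -
  obtain S0 where S0: "\<sigma> = boundaries K k #>\<^bsub>cycle_group K k\<^esub> S0"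
    using assms(1) by (rule homology_classE)
  then have S: "(\<lambda>s. S s + S0 s) \<in> boundaries K k"
    using assms(2) by (simp add: in_coset_boundaries_iff)
  have "(\<lambda>s. x s + S0 s) \<in> boundaries K k \<longleftrightarrow> (\<lambda>s. x s + S s) \<in> boundaries K k" for x
  proof -
    have "(\<lambda>s. (S s + S0 s) + (x s + S s)) = (\<lambda>s. x s + S0 s)"
      by (simp add: ac_simps)
    then show ?thesis using boundaries_add_iff[OF S, of "\<lambda>s. x s + S s"] by simp
  qed
  then show ?thesis unfolding S0 by (intro Set.set_eqI) (simp add: in_coset_boundaries_iff)
qed

lemma homology_class_nonempty:
  assumes "\<sigma> \<in> carrier (homology_group K k)"
  shows "\<sigma> \<noteq> {}"
proof -
  obtain S where "\<sigma> = boundaries K k #>\<^bsub>cycle_group K k\<^esub> S"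
    using assms by (rule homology_classE)
  then have "S \<in> \<sigma>" by (simp add: in_coset_boundaries_iff zero_in_boundaries)
  then show ?thesis by blast
qed

lemma homology_class_subset_cycles:
  assumes "\<sigma> \<in> carrier (homology_group K k)" and B: "boundaries K k \<subseteq> cycles K k"
  shows "\<sigma> \<subseteq> cycles K k"
proof
  fix x assume "x \<in> \<sigma>"
  obtain S where S: "S \<in> cycles K k" "\<sigma> = boundaries K k #>\<^bsub>cycle_group K k\<^esub> S"
    using assms(1) by (rule homology_classE)
  obtain h where h: "h \<in> cycles K k" "x = (\<lambda>s. h s + S s)"
    using \<open>x \<in> \<sigma>\<close> B unfolding S(2) r_coset_def by auto
  then show "x \<in> cycles K k"
    using S(1) by (auto simp: cycles_def boundary_map_add chain_group_add)
qed

lemma one_in_homology_group: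
  "\<one>\<^bsub>homology_group K k\<^esub> \<in> carrier (homology_group K k)"
proof -
  have "(\<lambda>s. 0) \<in> cycles K k"
    by (simp add: cycles_def zero_in_chain_group boundary_map_zero)
  then show ?thesis
    using coset_boundaries_eq[OF zero_in_boundaries, of K k]
    by (force simp: homology_group_def carrier_FactGroup cycle_group_def)
qed

text \<open>A chain with coefficients in \<open>bit\<close> is determined by its support. Finiteness
  ensures that the minimum in \<open>class_width\<close> is attained.\<close>

lemma finite_cycles:
  assumes "finite V" "K \<subseteq> Pow V"
  shows "finite (cycles K k)"
proof (rule inj_on_finite)
  show "inj_on (\<lambda>c. {s. c s \<noteq> 0}) (cycles K k)"
    by (intro inj_onI ext bit_eq_iff_nonzero) blast
  show "(\<lambda>c. {s. c s \<noteq> 0}) ` cycles K k \<subseteq> Pow (Pow V)"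
    using assms(2) unfolding cycles_def chain_group_iff by blast
  show "finite (Pow (Pow V))" using assms(1) by simp
qed

text \<open>Every coset in the union is the group of boundaries itself; nonemptiness of
  \<open>\<sigma>\<close> prevents the union from being empty.\<close>

lemma homology_incl_eq_one:
  assumes "\<sigma> \<noteq> {}" "\<sigma> \<subseteq> boundaries L k"
  shows "homology_incl L k \<sigma> = \<one>\<^bsub>homology_group L k\<^esub>"
proof -
  have "boundaries L k #>\<^bsub>cycle_group L k\<^esub> S = boundaries L k" if "S \<in> \<sigma>" for S
    using assms(2) that by (intro coset_boundaries_eq) blast
  then have "homology_incl L k \<sigma> = (\<Union>S\<in>\<sigma>. boundaries L k)"
    unfolding homology_incl_def by (rule SUP_cong[OF refl])
  then show ?thesis using assms(1) by (simp add: homology_group_def)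
qed

section \<open>Distances and width\<close>

lemma power_complex_subset_Pow: "power_complex V E n \<subseteq> Pow V"
  by (auto simp: power_complex_def clique_complex_def)

lemma graph_dist_refl [simp]: "graph_dist E v v = 0"
  by (simp add: graph_dist_def)

lemma power_complex_iff:
  "s \<in> power_complex V E n \<longleftrightarrow>
     s \<noteq> {} \<and> finite s \<and> s \<subseteq> V \<and> (\<forall>v\<in>s. \<forall>w\<in>s. graph_dist E v w \<le> n)"
proof -
  have "(v \<noteq> w \<longrightarrow> (v, w) \<in> graph_power V E n) \<longleftrightarrow> graph_dist E v w \<le> n"
    if "v \<in> V" "w \<in> V" for v w
    using that by (auto simp: graph_power_def)
  then show ?thesis
    unfolding power_complex_def clique_complex_def by blast
qed

lemma power_complex_mono: "m \<le> n \<Longrightarrow> power_complex V E m \<subseteq> power_complex V E n"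
  by (intro subsetI) (simp add: power_complex_iff, meson order_trans)

lemma graph_dist_le: "(v, w) \<in> E ^^ n \<Longrightarrow> graph_dist E v w \<le> n"
  unfolding graph_dist_def by (rule Least_le)

lemma relpow_graph_dist: "(v, w) \<in> E\<^sup>* \<Longrightarrow> (v, w) \<in> E ^^ graph_dist E v w"
  unfolding graph_dist_def rtrancl_power by (rule LeastI_ex)

text \<open>Concatenate two shortest walks; reachability guarantees that the least lengths are
  attained.\<close>

lemma graph_dist_triangle:
  assumes "(u, v) \<in> E\<^sup>*" "(v, w) \<in> E\<^sup>*"
  shows "graph_dist E u w \<le> graph_dist E u v + graph_dist E v w"
  using assms[THEN relpow_graph_dist] by (intro graph_dist_le) (auto simp: relpow_add)

text \<open>This removes the ceiling from all later estimates.\<close>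

lemma scaled_dist_le_iff:
  assumes "b > 0"
  shows "scaled_dist E b v w \<le> r \<longleftrightarrow> graph_dist E v w \<le> r * b"
proof -
  have "scaled_dist E b v w \<le> r \<longleftrightarrow> real (graph_dist E v w) / real b \<le> real r"
    unfolding scaled_dist_def by (simp add: nat_le_iff ceiling_le_iff)
  also have "\<dots> \<longleftrightarrow> real (graph_dist E v w) \<le> real (r * b)"
    using assms by (simp add: field_simps)
  finally show ?thesis by (simp only: of_nat_le_iff)
qed

section \<open>Stabilisation at the diameter, and the width of a cycle\<close>

lemma graph_dist_le_diam:
  assumes "finite V" "v \<in> V" "w \<in> V"
  shows "graph_dist E v w \<le> graph_diam V E"
proof -
  have "{graph_dist E v w | v w. v \<in> V \<and> w \<in> V} = (\<lambda>(v, w). graph_dist E v w) ` (V \<times> V)"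
    by auto
  then show ?thesis
    unfolding graph_diam_def using assms by (intro Max_ge) auto
qed

text \<open>Death times are sought only among stages up to the diameter, while
  \<open>(\<omega> + 1) b\<close> may exceed it; this allows the cut-off.\<close>

lemma power_complex_min_diam:
  assumes "finite V"
  shows "power_complex V E (min n (graph_diam V E)) = power_complex V E n"
proof -
  have "graph_power V E (min n (graph_diam V E)) = graph_power V E n"
    unfolding graph_power_def using graph_dist_le_diam[OF assms, of _ _ E] by auto
  then show ?thesis by (simp add: power_complex_def)
qed

text \<open>The vertex \<open>v\<close> attains the minimum. Vertices at equal level share a slice
  whose index is at most the eccentricity, so its diameter enters the maximum.\<close>

lemma cycle_widthE:
  assumes "finite (cycle_vertices S)" "cycle_vertices S \<noteq> {}"
  obtains v where "v \<in> cycle_vertices S"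
    "\<And>u w. u \<in> cycle_vertices S \<Longrightarrow> w \<in> cycle_vertices S \<Longrightarrow>
       scaled_dist E b v u = scaled_dist E b v w \<Longrightarrow> scaled_dist E b u w \<le> cycle_width E b S"
proof -
  define W where "W v = (MAX i\<in>{0..eccentricity E b S v}. scaled_diam E b (slice E b S v i))" for v
  have "cycle_width E b S = Min (W ` cycle_vertices S)"
    by (simp add: cycle_width_def W_def)
  also have "\<dots> \<in> W ` cycle_vertices S"
    using assms by (intro Min_in) auto
  finally obtain v where v: "v \<in> cycle_vertices S" "cycle_width E b S = W v" by blast
  have "scaled_dist E b u w \<le> W v"
    if uw: "u \<in> cycle_vertices S" "w \<in> cycle_vertices S" "scaled_dist E b v u = scaled_dist E b v w" for u w
  proof -
    define Y where "Y = slice E b S v (scaled_dist E b v u)"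
    have Y: "u \<in> Y" "w \<in> Y" using uw by (auto simp: Y_def slice_def)
    have "Y \<subseteq> cycle_vertices S" by (auto simp: Y_def slice_def)
    then have "finite Y" using assms(1) by (rule finite_subset)
    moreover have "{scaled_dist E b y y' | y y'. y \<in> Y \<and> y' \<in> Y}
        = (\<lambda>(y, y'). scaled_dist E b y y') ` (Y \<times> Y)" by auto
    ultimately have "scaled_dist E b u w \<le> scaled_diam E b Y"
      using Y unfolding scaled_diam_def by (auto intro!: Max_ge)
    also have "scaled_dist E b v u \<le> eccentricity E b S v"
      unfolding eccentricity_def using assms(1) uw(1) by (intro Max_ge) auto
    then have "scaled_diam E b Y \<le> W v"
      unfolding W_def Y_def by (intro Max_ge) auto
    finally show ?thesis .
  qed
  then show thesis using that v by metis
qed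

lemma cycle_is_boundary_of_width:
  assumes G: "finite_connected_simple_graph V E" and b: "b > 0"
    and S: "S \<in> cycles (power_complex V E b) 2"
  shows "S \<in> boundaries (power_complex V E ((cycle_width E b S + 1) * b)) 2"
proof (cases "S = (\<lambda>s. 0)")
  \<comment> \<open>The zero cycle has no vertices, so its width is a minimum over the empty set; it
    bounds at every stage.\<close>
  case True
  then show ?thesis by (simp add: zero_in_boundaries)
next
  case False
  have V: "finite V" and conn: "\<And>v w. v \<in> V \<Longrightarrow> w \<in> V \<Longrightarrow> (v, w) \<in> E\<^sup>*"
    using G unfolding finite_connected_simple_graph_def by blast+
  have triangle: "graph_dist E u w \<le> graph_dist E u v + graph_dist E v w"
    if "u \<in> V" "v \<in> V" "w \<in> V" for u v w
    using graph_dist_triangle conn that by metis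
  let ?m = "(cycle_width E b S + 1) * b"
  have Sc: "S \<in> carrier (chain_group (power_complex V E b) 2)"
    and Sb: "boundary_map (power_complex V E b) 2 S = (\<lambda>t. 0)"
    using S by (auto simp: cycles_def)
  have Ssimp: "s \<in> power_complex V E b" "card s = 3" if "S s \<noteq> 0" for s
    using Sc that unfolding chain_group_iff by auto
  have chain: "chain_on 3 V S"
    unfolding chain_on_def using Ssimp power_complex_subset_Pow by fast
  have bdS: "bd V S = (\<lambda>t. 0)"
    using Sb boundary_map_eq_bd[OF V power_complex_subset_Pow, of S E b 1] Sc
    by (simp add: numeral_2_eq_2)
  have CV: "cycle_vertices S \<subseteq> V"
    using chain unfolding chain_on_def cycle_vertices_def by blast
  have fin: "finite (cycle_vertices S)" using CV V by (rule finite_subset)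
  obtain s where s: "S s \<noteq> 0" using False by auto
  then have "s \<noteq> {}" using Ssimp(2)[OF s] by auto
  then have "cycle_vertices S \<noteq> {}" using s unfolding cycle_vertices_def by blast
  then obtain v where v: "v \<in> cycle_vertices S"
    and diam: "\<And>u w. u \<in> cycle_vertices S \<Longrightarrow> w \<in> cycle_vertices S \<Longrightarrow>
       scaled_dist E b v u = scaled_dist E b v w \<Longrightarrow> scaled_dist E b u w \<le> cycle_width E b S"
    using cycle_widthE[OF fin] by metis
  have inCV: "u \<in> cycle_vertices S" if "S s \<noteq> 0" "u \<in> s" for u s
    using that unfolding cycle_vertices_def by blast
  have edge: "graph_dist E u w \<le> b" if "S s \<noteq> 0" "u \<in> s" "w \<in> s" for s u w
    using Ssimp(1)[OF that(1)] that(2,3) unfolding power_complex_iff by blast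
  \<comment> \<open>An edge of \<open>S\<close> has length at most \<open>b\<close>, which is one
    unit of scaled distance.\<close>
  have step: "scaled_dist E b v u \<le> Suc (scaled_dist E b v w)"
    if "S s \<noteq> 0" "u \<in> s" "w \<in> s" for s u w
  proof -
    have "graph_dist E v u \<le> graph_dist E v w + graph_dist E w u"
      using triangle v CV inCV that by blast
    also have "\<dots> \<le> scaled_dist E b v w * b + b"
      using edge[OF that(1,3,2)] scaled_dist_le_iff[OF b, of E v w "scaled_dist E b v w"] by simp
    finally show ?thesis by (simp add: scaled_dist_le_iff[OF b])
  qed
  \<comment> \<open>The edge from \<open>u\<close> to \<open>u'\<close> costs at most
    \<open>b\<close>, and the move within a slice to \<open>w\<close> at most the width times
    \<open>b\<close>.\<close>
  have R: "graph_dist E u w \<le> ?m"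
    if "S s \<noteq> 0" "u \<in> s" "u' \<in> s" "w \<in> cycle_vertices S" "scaled_dist E b v u' = scaled_dist E b v w"
    for s u u' w
  proof -
    have "graph_dist E u w \<le> graph_dist E u u' + graph_dist E u' w"
      using triangle CV inCV that by blast
    also have "\<dots> \<le> b + cycle_width E b S * b"
      using edge[OF that(1-3)] diam[OF inCV[OF that(1,3)] that(4,5)]
      by (intro add_mono) (simp_all add: scaled_dist_le_iff[OF b])
    finally show ?thesis by simp
  qed
  obtain T where T: "chain_on 4 V T" "\<And>t u w. T t \<noteq> 0 \<Longrightarrow> u \<in> t \<Longrightarrow> w \<in> t \<Longrightarrow> graph_dist E u w \<le> ?m"
      "bd V T = S"
    
    by (rule sweepout_filling[where l = "scaled_dist E b v" and R = "\<lambda>u w. graph_dist E u w \<le> ?m",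
          OF V chain bdS step R]) blast+
  have "t \<in> power_complex V E ?m \<and> card t = Suc 3" if "T t \<noteq> 0" for t
  proof -
    have t: "t \<subseteq> V" "card t = 4" using T(1) that unfolding chain_on_def by blast+
    then have "finite t" "t \<noteq> {}" using V finite_subset by auto
    then show ?thesis using t T(2)[OF that] unfolding power_complex_iff by simp
  qed
  then have Tc: "T \<in> carrier (chain_group (power_complex V E ?m) (Suc 2))"
    unfolding chain_group_iff by simp
  moreover have "boundary_map (power_complex V E ?m) (Suc 2) T = S"
    using boundary_map_eq_bd[OF V power_complex_subset_Pow Tc] T(3) by simp
  ultimately have "S \<in> boundary_map (power_complex V E ?m) (Suc 2) ` carrier (chain_group (power_complex V E ?m) (Suc 2))"
    by (intro image_eqI[of S _ T]) simp_all
  then show ?thesis unfolding boundaries_def .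
qed


section \<open>Earlier classes and birth times\<close>

lemma one_in_earlier_classes:
  assumes "finite V" "b \<le> n"
  shows "\<one>\<^bsub>homology_group (power_complex V E n) k\<^esub> \<in> earlier_classes V E k b n"
proof (cases "b = 0")
  case False
  \<comment> \<open>The neutral class is the image of the neutral class of stage
    \<open>b - 1\<close>, because boundaries stay boundaries.\<close>
  let ?B = "\<one>\<^bsub>homology_group (power_complex V E (b - 1)) k\<^esub>"
  have B: "?B = boundaries (power_complex V E (b - 1)) k" by (simp add: homology_group_def)
  also have "\<dots> \<subseteq> boundaries (power_complex V E n) k"
    using assms by (intro boundaries_mono[OF _ power_complex_subset_Pow] power_complex_mono) auto
  finally have "homology_incl (power_complex V E n) k ?B = \<one>\<^bsub>homology_group (power_complex V E n) k\<^esub>"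
    using homology_class_nonempty[OF one_in_homology_group] by (intro homology_incl_eq_one)
  then show ?thesis
    using False one_in_homology_group unfolding earlier_classes_def by (metis imageI)
qed (simp add: earlier_classes_def)

text \<open>Used in contrapositive form: no representative of a class born at \<open>b\<close>
  bounds at stage \<open>b\<close>.\<close>

lemma boundary_class_in_earlier_classes:
  assumes "finite V" "\<sigma> \<in> carrier (homology_group (power_complex V E b) k)"
    "S \<in> \<sigma>" "S \<in> boundaries (power_complex V E b) k"
  shows "\<sigma> \<in> earlier_classes V E k b b"
proof -
  have "\<sigma> = \<one>\<^bsub>homology_group (power_complex V E b) k\<^esub>"
    using homology_class_eq_coset[OF assms(2,3)] coset_boundaries_eq[OF assms(4)]
    by (simp add: homology_group_def)
  then show ?thesis using one_in_earlier_classes[OF assms(1) order_refl] by metis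
qed

text \<open>Distance zero means equality, so stage 0 has only vertices. This rules out the birth
  time 0, where scaled distances divide by zero.\<close>

lemma cycles_power_complex_0:
  assumes G: "finite_connected_simple_graph V E" and S: "S \<in> cycles (power_complex V E 0) (Suc k)"
  shows "S = (\<lambda>s. 0)"
proof (rule ext, rule ccontr)
  fix s assume "S s \<noteq> 0"
  then have s: "s \<in> power_complex V E 0" "card s = Suc (Suc k)"
    using S unfolding cycles_def chain_group_iff by blast+
  have "v = w" if "v \<in> s" "w \<in> s" for v w
  proof -
    have "graph_dist E v w = 0" "(v, w) \<in> E\<^sup>*"
      using s(1) that G unfolding power_complex_iff finite_connected_simple_graph_def by blast+
    then show ?thesis using relpow_graph_dist[of v w E] by simp
  qed
  then have "card s \<le> Suc 0"
    using s(1) by (simp add: power_complex_iff card_le_Suc0_iff_eq)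
  then show False using s(2) by simp
qed

theorem theorem6p4:
  fixes V :: "'a set" and E :: "('a \<times> 'a) set"
    and PD :: "(nat \<times> enat) multiset" and b :: nat and d :: enat
    and \<sigma> :: "('a set \<Rightarrow> bit) set"
  assumes "finite_connected_simple_graph V E"
    and "is_persistence_diagram V E 2 PD"
    and "(b, d) \<in># PD"
    and "\<sigma> \<in> carrier (homology_group (power_complex V E b) 2)"
    and "corresponds_to V E 2 (b, d) \<sigma>"
  shows "d \<le> enat ((class_width E b \<sigma> + 1) * b)"
proof -
  have V: "finite V" using assms(1) by (simp add: finite_connected_simple_graph_def)
  let ?K = "power_complex V E"
  note mono = boundaries_mono[OF V power_complex_subset_Pow power_complex_mono]
  have new: "\<sigma> \<notin> earlier_classes V E 2 b b"
    and d: "d = Inf {enat n | n. b < n \<and> n \<le> graph_diam V E \<and>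
                  homology_incl (?K n) 2 \<sigma> \<in> earlier_classes V E 2 b n}"
    using assms(5) unfolding corresponds_to_def prod.case by blast+
  have notbd: "S \<notin> boundaries (?K b) 2" if "S \<in> \<sigma>" for S
    using boundary_class_in_earlier_classes[OF V assms(4) that] new by blast
  have face: "t \<in> ?K b" if "s \<in> ?K b" "t \<subseteq> s" "t \<noteq> {}" for s t
    using that finite_subset[of t s] unfolding power_complex_iff by blast
  have "boundaries (?K b) 2 \<subseteq> cycles (?K b) 2"
    using boundaries_subset_cycles[OF V power_complex_subset_Pow face, where k = 1]
    unfolding Suc_1 .
  then have cyc: "\<sigma> \<subseteq> cycles (?K b) 2"
    by (rule homology_class_subset_cycles[OF assms(4)])
  then have "finite \<sigma>"
    by (rule finite_subset) (rule finite_cycles[OF V power_complex_subset_Pow])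
  then have "class_width E b \<sigma> \<in> cycle_width E b ` \<sigma>"
    unfolding class_width_def using homology_class_nonempty[OF assms(4)] by (intro Min_in) auto
  then obtain S where S: "S \<in> \<sigma>" "class_width E b \<sigma> = cycle_width E b S" by blast
  have "b > 0"
  proof (rule ccontr)
    assume "\<not> b > 0"
    then have "S = (\<lambda>s. 0)"
      using cycles_power_complex_0[OF assms(1), of S 1] S(1) cyc unfolding Suc_1 by auto
    then show False using notbd[OF S(1)] zero_in_boundaries by metis
  qed
  define m where "m = (class_width E b \<sigma> + 1) * b"
  \<comment> \<open>The index must not exceed the diameter to compete in the infimum defining
    \<open>d\<close>.\<close>
  define n where "n = min m (graph_diam V E)"
  have "S \<in> boundaries (?K m) 2"
    unfolding m_def S(2)
    using assms(1) \<open>b > 0\<close> cyc S(1) by (intro cycle_is_boundary_of_width) auto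
  then have Sn: "S \<in> boundaries (?K n) 2"
    unfolding n_def power_complex_min_diam[OF V] .
  \<comment> \<open>Otherwise \<open>n \<le> b\<close>, and \<open>S\<close> would already bound at
    stage \<open>b\<close> by monotonicity.\<close>
  have "b < n"
    using mono[of n b E 2] Sn notbd[OF S(1)] by (meson not_le subsetD)
  \<comment> \<open>Any representative differs from \<open>S\<close> by a boundary of stage
    \<open>b\<close>, which remains a boundary at stage \<open>n\<close>.\<close>
  have "\<sigma> \<subseteq> boundaries (?K n) 2"
  proof
    fix x assume "x \<in> \<sigma>"
    then have "(\<lambda>s. x s + S s) \<in> boundaries (?K b) 2"
      using homology_class_eq_coset[OF assms(4) S(1)] in_coset_boundaries_iff by metis
    then have "(\<lambda>s. S s + x s) \<in> boundaries (?K n) 2"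
      using mono[of b n E 2] \<open>b < n\<close> by (auto simp: add.commute)
    then show "x \<in> boundaries (?K n) 2"
      using boundaries_add_iff[OF Sn] by blast
  qed
  then have "homology_incl (?K n) 2 \<sigma> = \<one>\<^bsub>homology_group (?K n) 2\<^esub>"
    by (rule homology_incl_eq_one[OF homology_class_nonempty[OF assms(4)]])
  then have "homology_incl (?K n) 2 \<sigma> \<in> earlier_classes V E 2 b n"
    using one_in_earlier_classes[OF V, of b n E 2] \<open>b < n\<close> by simp
  \<comment> \<open>The class has become zero at stage \<open>n\<close>, so \<open>n\<close> belongs
    to the set whose infimum is \<open>d\<close>.\<close>
  then have "d \<le> enat n"
    unfolding d using \<open>b < n\<close> by (intro Inf_lower) (auto simp: n_def)
  also have "\<dots> \<le> enat m" by (simp add: n_def)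
  finally show ?thesis unfolding m_def .
qed

end
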